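(* Let $\{\mu_n\}_{n\in\mathbb N}$ be a sequence of Ising measures on a sequence $G_n(V_n,E_n)$ of finite graphs with maximum degree $d$, at inverse temperature $\beta<\beta_c(d)$, where $\beta_c(d)$ is the Tree Uniqueness Threshold, defined by $\tanh\beta_c(d)=\frac1{d-1}$. Then there is no random sparse reconstruction for $\{\mu_n\}_{n\in\mathbb N}$.
   Context: Ising measure on a finite graph $G(V,E)$ at inverse temperature $\beta$ (zero external field, coupling $1$): $\mu[\sigma]\propto\exp\big(\beta\sum_{(x,y)\in E}\sigma_x\sigma_y\big)$ on $\{-1,1\}^V$. Clue: $\mathsf{clue}(f\,|\,U):=\mathrm{Var}(\mathbb E[f\,|\,\mathcal F_U])/\mathrm{Var}(f)$, where $\mathcal F_U$ is generated by the coordinates in $U$ (clue $=0$ if $\mathrm{Var}(f)=0$). There is random sparse reconstruction for $\{(\{-1,1\}^{V_n},\mu_n)\}$ if there exist Boolean functions $f_n:\{-1,1\}^{V_n}\to\{-1,1\}$, random subsets $\mathcal U_n\subseteq V_n$ independent of the spin system with $\max_{j\in V_n}\mathbb P[j\in\mathcal U_n]\to0$, and $c>0$ such that $\mathbb E[\mathsf{clue}(f_n\,|\,\mathcal U_n)]>c$ for all $n$. *)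

theory Defs
  imports "HOL-Probability.Probability"
begin

text \<open>Finite simple graphs: an edge is the two-element set of its end points.\<close>

definition finite_graph :: "'a set \<Rightarrow> 'a set set \<Rightarrow> bool" where
  "finite_graph V E \<longleftrightarrow> finite V \<and> (\<forall>e\<in>E. e \<subseteq> V \<and> card e = 2)"

definition vertex_degree :: "'a set set \<Rightarrow> 'a \<Rightarrow> nat" where
  "vertex_degree E x = card {e \<in> E. x \<in> e}"

text \<open>Spins are real numbers; a configuration is \<^term>\<open>undefined\<close> outside of the vertex set.\<close>

definition spin_configs :: "'a set \<Rightarrow> ('a \<Rightarrow> real) set" where
  "spin_configs V = V \<rightarrow>\<^sub>E {-1, 1}"

text \<open>For an edge $e = \{x, y\}$ the product over $e$ is $\sigma_x \sigma_y$.\<close>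

definition ising_weight :: "'a set set \<Rightarrow> real \<Rightarrow> ('a \<Rightarrow> real) \<Rightarrow> real" where
  "ising_weight E \<beta> \<sigma> = exp (\<beta> * (\<Sum>e\<in>E. \<Prod>x\<in>e. \<sigma> x))"

definition ising :: "'a set \<Rightarrow> 'a set set \<Rightarrow> real \<Rightarrow> ('a \<Rightarrow> real) measure" where
  "ising V E \<beta> = point_measure (spin_configs V)
     (\<lambda>\<sigma>. ennreal (ising_weight E \<beta> \<sigma> / (\<Sum>\<tau>\<in>spin_configs V. ising_weight E \<beta> \<tau>)))"

definition coord_algebra :: "('a \<Rightarrow> real) measure \<Rightarrow> 'a set \<Rightarrow> ('a \<Rightarrow> real) measure" where
  "coord_algebra M U =
     sigma (space M) {(\<lambda>\<sigma>. \<sigma> j) -` B \<inter> space M | j B. j \<in> U \<and> B \<in> sets borel}"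

definition clue :: "('a \<Rightarrow> real) measure \<Rightarrow> (('a \<Rightarrow> real) \<Rightarrow> real) \<Rightarrow> 'a set \<Rightarrow> real" where
  "clue M f U =
     (if prob_space.variance M f = 0 then 0
      else prob_space.variance M (real_cond_exp M (coord_algebra M U) f)
             / prob_space.variance M f)"

text \<open>The random set \<open>\<U>\<^sub>n\<close> is given by its law \<open>U n\<close> on the subsets of \<open>V n\<close>. As
  \<open>\<U>\<^sub>n\<close> is independent of the spins, the joint law is the product of \<open>\<mu> n\<close> and \<open>U n\<close>, and
  the clue of a realisation of \<open>\<U>\<^sub>n\<close> is computed under \<open>\<mu> n\<close> alone. If \<open>V n\<close> is empty for
  some \<open>n\<close>, the clue vanishes for this \<open>n\<close>, so the value of \<^term>\<open>Max {}\<close> does not matter.\<close>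

definition random_sparse_reconstruction ::
    "(nat \<Rightarrow> 'a set) \<Rightarrow> (nat \<Rightarrow> ('a \<Rightarrow> real) measure) \<Rightarrow> bool" where
  "random_sparse_reconstruction V \<mu> \<longleftrightarrow>
     (\<exists>(f :: nat \<Rightarrow> ('a \<Rightarrow> real) \<Rightarrow> real) (U :: nat \<Rightarrow> 'a set pmf) (c :: real).
        (\<forall>n. f n \<in> spin_configs (V n) \<rightarrow> {-1, 1}) \<and>
        (\<forall>n. set_pmf (U n) \<subseteq> Pow (V n)) \<and>
        (\<lambda>n. Max ((\<lambda>j. measure_pmf.prob (U n) {A. j \<in> A}) ` V n)) \<longlonglongrightarrow> 0 \<and>
        c > 0 \<and>
        (\<forall>n. measure_pmf.expectation (U n) (clue (\<mu> n) (f n)) > c))"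

text \<open>The equation $\tanh \beta_c(d) = 1/(d-1)$ has a real solution for $d \ge 3$ only;
  for $d = 2$ it reads $\tanh \beta_c = 1$, i.e. $\beta_c = \infty$. The definition is not
  meaningful for $d < 2$.\<close>

definition tree_uniqueness_threshold :: "nat \<Rightarrow> ereal" where
  "tree_uniqueness_threshold d =
     (if d = 2 then \<infinity> else ereal (THE b::real. tanh b = 1 / (real d - 1)))"

lemma tree_uniqueness_threshold_eq:
  assumes "d \<ge> 3" and "tanh (b::real) = 1 / (real d - 1)"
  shows "tree_uniqueness_threshold d = ereal b"
proof -
  have "(THE b::real. tanh b = 1 / (real d - 1)) = b"
  proof (rule the_equality)
    fix x :: real
    assume "tanh x = 1 / (real d - 1)"
    then have "tanh x = tanh b" by (simp only: assms(2))
    then show "x = b" by (simp only: tanh_real_eq_iff)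
  qed (rule assms(2))
  with assms(1) show ?thesis
    by (simp add: tree_uniqueness_threshold_def)
qed

lemma tanh_tree_uniqueness_threshold:
  assumes "d \<ge> 3"
  obtains b :: real where "tree_uniqueness_threshold d = ereal b" "tanh b = 1 / (real d - 1)"
proof -
  let ?q = "real d / (real d - 2)"
  have "tanh (ln (sqrt ?q)) = (?q - 1) / (?q + 1)"
    using assms by (simp add: tanh_ln_real)
  also have "?q - 1 = 2 / (real d - 2)"
    using assms by (simp add: field_simps)
  also have "?q + 1 = 2 * (real d - 1) / (real d - 2)"
    using assms by (simp add: field_simps)
  also have "2 / (real d - 2) / (2 * (real d - 1) / (real d - 2)) = 1 / (real d - 1)"
  proof -
    have "2 / a / (2 * b / a) = 1 / b" if "a \<noteq> 0" for a b :: real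
      using that by simp
    note * = this
    show ?thesis by (rule *) (use assms in auto)
  qed
  finally have "tanh (ln (sqrt ?q)) = 1 / (real d - 1)" .
  with assms show ?thesis
    by (intro that) (auto intro: tree_uniqueness_threshold_eq)
qed

lemma finite_spin_configs: "finite V \<Longrightarrow> finite (spin_configs V)"
  unfolding spin_configs_def by (intro finite_PiE) auto

lemma spin_configs_nonempty: "spin_configs V \<noteq> {}"
  unfolding spin_configs_def by (simp add: PiE_eq_empty_iff)

lemma prob_space_ising:
  assumes "finite V"
  shows "prob_space (ising V E \<beta>)"
proof -
  let ?Z = "\<Sum>\<tau>\<in>spin_configs V. ising_weight E \<beta> \<tau>"
  have Z: "?Z > 0"
    using assms finite_spin_configs spin_configs_nonempty
    by (intro sum_pos) (auto simp: ising_weight_def)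
  have "(\<Sum>\<sigma>\<in>spin_configs V. ising_weight E \<beta> \<sigma> / ?Z) = 1"
    using Z by (simp flip: sum_divide_distrib)
  moreover have "ising_weight E \<beta> \<sigma> / ?Z \<ge> 0" for \<sigma>
    using Z by (simp add: ising_weight_def)
  ultimately have "(\<Sum>\<sigma>\<in>spin_configs V. ennreal (ising_weight E \<beta> \<sigma> / ?Z)) = 1"
    by (simp add: sum_ennreal)
  then show ?thesis
    unfolding ising_def
    by (intro prob_spaceI)
       (simp add: space_point_measure emeasure_point_measure_finite finite_spin_configs assms)
qed

lemma subalgebra_coord_algebra: "subalgebra (ising V E \<beta>) (coord_algebra (ising V E \<beta>) U)"
proof -
  have "sets (ising V E \<beta>) = Pow (space (ising V E \<beta>))"
    by (simp add: ising_def sets_point_measure space_point_measure)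
  moreover have "sets (coord_algebra (ising V E \<beta>) U) \<subseteq> Pow (space (coord_algebra (ising V E \<beta>) U))"
    by (rule sets.space_closed)
  moreover have "space (coord_algebra (ising V E \<beta>) U) = space (ising V E \<beta>)"
    unfolding coord_algebra_def by (rule space_measure_of) blast
  ultimately show ?thesis
    unfolding subalgebra_def by simp
qed

end

theory Submission
  imports Defs
begin

text \<open>
  Let $T f = \mathbb E_{\mathcal U}\, \mathbb E[f \mid \mathcal F_{\mathcal U}]$. This operator is
  self-adjoint in $L^2(\mu)$, and for centred $f$ the expected clue is
  $\langle f, T f\rangle / \langle f, f\rangle$. A spin flip at $x$ changes $T f$ only through
  the realisations of $\mathcal U$ that contain $x$, and there by at most $C$ times the Lipschitz
  constant of $f$ for the Hamming distance, where $C$ depends on $d$ and $\beta$ only. Hence $T$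
  contracts Lipschitz constants by $\kappa = C \max_x \mathbb P[x \in \mathcal U]$. Since
  $k \mapsto \|T^k f\|$ is log-convex, its exponential decay rate $\kappa$ bounds the first
  ratio $\|T f\| / \|f\|$ as well, so the expected clue is at most $\kappa$.

  For the constant $C$: flipping a pinned spin amounts to reversing the signs of the couplings at
  this vertex. Reversing a single coupling moves the marginal of the neighbour $u$ by at most
  $\tanh \beta$ and leaves the law given $\sigma_u$ unchanged. So the influence of a vertex is at
  most $1$ plus $\tanh \beta$ times the influences of its neighbours in smaller graphs, where they
  have at most $d - 1$ neighbours left. The recursion is summable if $(d - 1) \tanh \beta < 1$.
\<close>

subsection \<open>Averages with pinned spins\<close>

text \<open>\<open>W\<close> holds the free vertices; every other value, also outside the graph, is
  pinned to \<open>\<eta>\<close>. Since these are total functions, pinning one more vertex is just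
  a smaller \<open>W\<close> with an updated \<open>\<eta>\<close>.\<close>

definition configs :: "'a set \<Rightarrow> ('a \<Rightarrow> real) \<Rightarrow> ('a \<Rightarrow> real) set" where
  "configs W \<eta> = {\<sigma>. (\<forall>x\<in>W. \<sigma> x \<in> {-1, 1}) \<and> (\<forall>x. x \<notin> W \<longrightarrow> \<sigma> x = \<eta> x)}"

text \<open>This is the conditional expectation of \<open>f\<close> under the law proportional to
  \<open>w\<close>, given the values of \<open>\<eta>\<close> off \<open>W\<close>.\<close>

definition avg :: "(('a \<Rightarrow> real) \<Rightarrow> real) \<Rightarrow> 'a set \<Rightarrow> (('a \<Rightarrow> real) \<Rightarrow> real) \<Rightarrow> ('a \<Rightarrow> real) \<Rightarrow> real" where
  "avg w W f \<eta> = (\<Sum>\<sigma>\<in>configs W \<eta>. w \<sigma> * f \<sigma>) / (\<Sum>\<sigma>\<in>configs W \<eta>. w \<sigma>)"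

text \<open>Couplings may vary from edge to edge and have either sign, because the influence
  recursion reverses them one at a time and so leaves the class of Ising weights with constant
  coupling.\<close>

definition pair_weight :: "'a set set \<Rightarrow> ('a set \<Rightarrow> real) \<Rightarrow> ('a \<Rightarrow> real) \<Rightarrow> real" where
  "pair_weight E J \<sigma> = exp (\<Sum>e\<in>E. J e * (\<Prod>x\<in>e. \<sigma> x))"

text \<open>This is the Lipschitz condition for the Hamming distance, expressed through single spin
  flips.\<close>

definition flip_lipschitz :: "'a set \<Rightarrow> real \<Rightarrow> (('a \<Rightarrow> real) \<Rightarrow> real) \<Rightarrow> bool" where
  "flip_lipschitz V L f \<longleftrightarrow>
     (\<forall>\<sigma>\<in>spin_configs V. \<forall>x\<in>V. \<bar>f (\<sigma>(x := 1)) - f (\<sigma>(x := -1))\<bar> \<le> L)"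

lemma mem_spin_configs_iff:
  "\<sigma> \<in> spin_configs V \<longleftrightarrow> (\<forall>x\<in>V. \<sigma> x \<in> {-1, 1}) \<and> (\<forall>x. x \<notin> V \<longrightarrow> \<sigma> x = undefined)"
  by (auto simp: spin_configs_def PiE_iff extensional_def)

lemma configs_empty [simp]: "configs {} \<eta> = {\<eta>}"
  by (auto simp: configs_def)

lemma configs_split:
  assumes "v \<in> W"
  shows "configs W \<eta> = configs (W - {v}) (\<eta>(v := 1)) \<union> configs (W - {v}) (\<eta>(v := -1))"
  using assms by (auto simp: configs_def)

lemma configs_split_disjoint:
  "configs (W - {v}) (\<eta>(v := 1)) \<inter> configs (W - {v}) (\<eta>(v := -1)) = {}"
  by (auto simp: configs_def)

lemma finite_configs: "finite W \<Longrightarrow> finite (configs W \<eta>)"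
proof (induction W arbitrary: \<eta> rule: finite_induct)
  case (insert v W)
  then have "insert v W - {v} = W"
    by auto
  with insert configs_split[of v "insert v W" \<eta>] show ?case
    by auto
qed auto

lemma configs_nonempty: "configs W \<eta> \<noteq> {}"
proof -
  have "(\<lambda>x. if x \<in> W then 1 else \<eta> x) \<in> configs W \<eta>"
    by (auto simp: configs_def)
  then show ?thesis
    by blast
qed

lemma configs_subset_spin_configs:
  "W \<subseteq> V \<Longrightarrow> \<eta> \<in> spin_configs V \<Longrightarrow> configs W \<eta> \<subseteq> spin_configs V"
  by (fastforce simp: configs_def mem_spin_configs_iff)

lemma spin_configs_upd:
  "\<sigma> \<in> spin_configs V \<Longrightarrow> v \<in> V \<Longrightarrow> s \<in> {-1, 1} \<Longrightarrow> \<sigma>(v := s) \<in> spin_configs V"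
  by (auto simp: mem_spin_configs_iff)

lemma configs_cong: "(\<And>x. x \<notin> W \<Longrightarrow> \<eta> x = \<eta>' x) \<Longrightarrow> configs W \<eta> = configs W \<eta>'"
  by (auto simp: configs_def)

lemma configs_sum_split:
  assumes "finite W" "v \<in> W"
  shows "(\<Sum>\<sigma>\<in>configs W \<eta>. g \<sigma>) =
    (\<Sum>\<sigma>\<in>configs (W - {v}) (\<eta>(v := 1)). g \<sigma>) + (\<Sum>\<sigma>\<in>configs (W - {v}) (\<eta>(v := -1)). g \<sigma>)"
  unfolding configs_split[OF assms(2)]
  by (intro sum.union_disjoint finite_configs configs_split_disjoint) (use assms in auto)

lemma sum_configs_pos:
  assumes "finite W" "\<And>\<sigma>. w \<sigma> > 0"
  shows "(\<Sum>\<sigma>\<in>configs W \<eta>. w \<sigma> :: real) > 0"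
  by (intro sum_pos finite_configs configs_nonempty assms)

lemma avg_diff_le:
  assumes "finite W" "\<And>\<sigma>. w \<sigma> > 0" "\<And>\<sigma>. \<sigma> \<in> configs W \<eta> \<Longrightarrow> \<bar>f \<sigma> - g \<sigma>\<bar> \<le> L"
  shows "\<bar>avg w W f \<eta> - avg w W g \<eta>\<bar> \<le> L"
proof -
  let ?C = "configs W \<eta>"
  have Z: "(\<Sum>\<sigma>\<in>?C. w \<sigma>) > 0"
    using assms by (intro sum_configs_pos)
  have "\<bar>\<Sum>\<sigma>\<in>?C. w \<sigma> * (f \<sigma> - g \<sigma>)\<bar> \<le> (\<Sum>\<sigma>\<in>?C. w \<sigma> * L)"
    using assms by (intro order_trans[OF sum_abs] sum_mono)
      (auto simp: abs_mult less_imp_le intro!: mult_mono)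
  also have "\<dots> = L * (\<Sum>\<sigma>\<in>?C. w \<sigma>)"
    by (simp add: sum_distrib_left mult.commute)
  finally have "\<bar>\<Sum>\<sigma>\<in>?C. w \<sigma> * (f \<sigma> - g \<sigma>)\<bar> / (\<Sum>\<sigma>\<in>?C. w \<sigma>) \<le> L"
    using Z by (simp add: divide_le_eq)
  moreover have "avg w W f \<eta> - avg w W g \<eta>
      = (\<Sum>\<sigma>\<in>?C. w \<sigma> * (f \<sigma> - g \<sigma>)) / (\<Sum>\<sigma>\<in>?C. w \<sigma>)"
    by (simp add: avg_def right_diff_distrib sum_subtractf diff_divide_distrib)
  ultimately show ?thesis
    using Z by (simp add: abs_divide)
qed

lemma avg_scale_weight:
  assumes "c \<noteq> 0" "\<And>\<sigma>. \<sigma> \<in> configs W \<eta> \<Longrightarrow> w' \<sigma> = c * w \<sigma>"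
  shows "avg w' W f \<eta> = avg w W f \<eta>"
proof -
  have "(\<Sum>\<sigma>\<in>configs W \<eta>. w' \<sigma> * f \<sigma>) = c * (\<Sum>\<sigma>\<in>configs W \<eta>. w \<sigma> * f \<sigma>)"
    using assms(2) by (simp add: sum_distrib_left mult.assoc)
  moreover have "(\<Sum>\<sigma>\<in>configs W \<eta>. w' \<sigma>) = c * (\<Sum>\<sigma>\<in>configs W \<eta>. w \<sigma>)"
    using assms(2) by (simp add: sum_distrib_left)
  ultimately show ?thesis
    using assms(1) by (simp add: avg_def)
qed

text \<open>\<open>A\<close> and \<open>B\<close> are the weights of the two values of a spin, and
  reversing a coupling tilts them by \<open>exp (-2 * s)\<close> and \<open>exp (2 * s)\<close>.
  With \<open>y = exp s\<close> the change of the marginal is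
  \<open>A * B * (y\<^sup>2 - 1 / y\<^sup>2) / ?D\<close>. Completing the square bounds
  \<open>?D\<close> below by \<open>A * B * (y + 1 / y)\<^sup>2\<close>, which leaves
  \<open>tanh s\<close>.\<close>

lemma two_point_bias_le_tanh:
  fixes A B s b :: real
  assumes A: "A > 0" and B: "B > 0" and s: "\<bar>s\<bar> \<le> b"
  shows "\<bar>A / (A + B) - A * exp (-2 * s) / (A * exp (-2 * s) + B * exp (2 * s))\<bar> \<le> tanh b"
proof -
  define y where "y = exp s"
  have y: "y > 0"
    by (simp add: y_def)
  have e: "exp (-2 * s) = 1 / y\<^sup>2" "exp (2 * s) = y\<^sup>2"
    by (simp_all add: y_def exp_minus field_simps power2_eq_square flip: exp_add)
  let ?D = "(A + B) * (A / y\<^sup>2 + B * y\<^sup>2)"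
  have D: "?D > 0"
    using A B y by (intro mult_pos_pos add_pos_pos divide_pos_pos) auto
  have "?D - A * B * (y + 1 / y)\<^sup>2 = (A / y - B * y)\<^sup>2"
    using y by (simp add: field_simps power2_eq_square)
  then have D_ge: "A * B * (y + 1 / y)\<^sup>2 \<le> ?D"
    by (smt (verit) zero_le_power2)
  have E: "A * B * (y + 1 / y)\<^sup>2 > 0"
    using A B y by (intro mult_pos_pos zero_less_power add_pos_pos) auto
  have X: "A / y\<^sup>2 + B * y\<^sup>2 > 0"
    using A B y by (intro add_pos_pos) auto
  have "A / (A + B) - (A / y\<^sup>2) / (A / y\<^sup>2 + B * y\<^sup>2) = A * B * (y\<^sup>2 - 1 / y\<^sup>2) / ?D"
  proof -
    have "A * (A / y\<^sup>2 + B * y\<^sup>2) - A / y\<^sup>2 * (A + B) = A * B * (y\<^sup>2 - 1 / y\<^sup>2)"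
      by (simp add: algebra_simps add_divide_distrib)
    then show ?thesis
      using A B X by (subst diff_frac_eq) auto
  qed
  moreover have "\<bar>A * B * (y\<^sup>2 - 1 / y\<^sup>2) / ?D\<bar> \<le> \<bar>A * B * (y\<^sup>2 - 1 / y\<^sup>2)\<bar> / (A * B * (y + 1 / y)\<^sup>2)"
    using D E D_ge by (simp only: abs_divide) (intro divide_left_mono, auto intro!: mult_pos_pos)
  moreover have "\<bar>A * B * (y\<^sup>2 - 1 / y\<^sup>2)\<bar> / (A * B * (y + 1 / y)\<^sup>2) = \<bar>(y - 1 / y) / (y + 1 / y)\<bar>"
  proof -
    have q: "y\<^sup>2 - 1 / y\<^sup>2 = (y - 1 / y) * (y + 1 / y)"
      using y by (simp add: field_simps power2_eq_square)
    have "y + 1 / y > 0"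
      using y by (intro add_pos_pos) auto
    then show ?thesis
      unfolding q using A B by (simp add: abs_mult abs_divide power2_eq_square)
  qed
  moreover have "(y - 1 / y) / (y + 1 / y) = tanh s"
    by (simp add: y_def tanh_altdef exp_minus inverse_eq_divide)
  moreover have "\<bar>tanh s\<bar> \<le> tanh b"
    using s by (auto simp: abs_le_iff simp flip: tanh_minus)
  ultimately have "\<bar>A / (A + B) - (A / y\<^sup>2) / (A / y\<^sup>2 + B * y\<^sup>2)\<bar> \<le> tanh b"
    by linarith
  then show ?thesis
    unfolding e by simp
qed

text \<open>Each quotient is a mixture of the conditional averages \<open>F / A\<close> and
  \<open>G / B\<close>. The tilt changes only the mixing probability, so the difference factors as
  \<open>(?p - ?q) * (F / A - G / B)\<close>.\<close>

lemma mixture_diff_le: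
  fixes A B F G s b :: real
  assumes "A > 0" "B > 0" "\<bar>s\<bar> \<le> b"
  shows "\<bar>(F + G) / (A + B) - (F * exp (-2 * s) + G * exp (2 * s)) / (A * exp (-2 * s) + B * exp (2 * s))\<bar>
    \<le> tanh b * \<bar>F / A - G / B\<bar>"
proof -
  let ?p = "A / (A + B)" and ?q = "A * exp (-2 * s) / (A * exp (-2 * s) + B * exp (2 * s))"
  have mix: "(F * c + G * d) / (A * c + B * d)
      = A * c / (A * c + B * d) * (F / A) + (1 - A * c / (A * c + B * d)) * (G / B)"
    if "c > 0" "d > 0" for c d
  proof -
    have "A * c + B * d > 0"
      using assms that by (intro add_pos_pos) auto
    then have *: "1 - A * c / (A * c + B * d) = B * d / (A * c + B * d)"
      by (simp add: field_simps)
    have "(F * c + G * d) / (A * c + B * d) = F * c / (A * c + B * d) + G * d / (A * c + B * d)"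
      by (simp add: add_divide_distrib)
    with assms show ?thesis
      unfolding * by (simp add: mult.commute)
  qed
  have "(F + G) / (A + B) - (F * exp (-2 * s) + G * exp (2 * s)) / (A * exp (-2 * s) + B * exp (2 * s))
      = (?p - ?q) * (F / A - G / B)"
  proof -
    have "(F + G) / (A + B) = ?p * (F / A) + (1 - ?p) * (G / B)"
      using mix[of 1 1] by (simp only: mult_1_right zero_less_one simp_thms)
    moreover have "p * x + (1 - p) * z - (q * x + (1 - q) * z) = (p - q) * (x - z)" for p q x z :: real
      by (simp add: algebra_simps)
    ultimately show ?thesis
      using mix[of "exp (-2 * s)" "exp (2 * s)"] by (simp only: exp_gt_zero simp_thms)
  qed
  then show ?thesis
    using two_point_bias_le_tanh[OF assms] by (simp only: abs_mult) (intro mult_right_mono, auto)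
qed

section \<open>Reversing the signs of couplings\<close>

lemma pair_weight_pos [simp]: "pair_weight E J \<sigma> > 0"
  by (simp add: pair_weight_def)

lemma pair_weight_upd:
  assumes "finite E" "e \<in> E"
  shows "pair_weight E (J(e := - J e)) \<sigma> = pair_weight E J \<sigma> * exp (-2 * (J e * (\<Prod>x\<in>e. \<sigma> x)))"
  using assms by (simp add: pair_weight_def sum.remove[OF assms] flip: exp_add)

text \<open>When both end points are pinned, the reversal multiplies all weights by the same factor,
  which cancels in the average.\<close>

lemma avg_edge_flip_pinned:
  assumes "finite E" "e \<in> E" "e \<inter> W = {}"
  shows "avg (pair_weight E (J(e := - J e))) W f \<eta> = avg (pair_weight E J) W f \<eta>"
proof (rule avg_scale_weight[where c = "exp (-2 * (J e * (\<Prod>x\<in>e. \<eta> x)))"])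
  fix \<sigma> assume "\<sigma> \<in> configs W \<eta>"
  then have "(\<Prod>x\<in>e. \<sigma> x) = (\<Prod>x\<in>e. \<eta> x)"
    using assms(3) by (intro prod.cong) (auto simp: configs_def)
  then show "pair_weight E (J(e := - J e)) \<sigma> = exp (-2 * (J e * (\<Prod>x\<in>e. \<eta> x))) * pair_weight E J \<sigma>"
    by (simp add: pair_weight_upd[OF assms(1,2)])
qed simp

text \<open>As the spin at \<open>v\<close> is pinned to 1, the reversal multiplies the weight by a
  factor depending on the spin at \<open>u\<close> alone. The law given that spin is unchanged, so
  the mixture estimate applies with the two values at \<open>u\<close> as components.\<close>

lemma avg_edge_flip_le:
  assumes "finite W" "finite E" "{v, u} \<in> E" "v \<notin> W" "u \<in> W" "\<eta> v = 1" "\<bar>J {v, u}\<bar> \<le> b"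
  shows "\<bar>avg (pair_weight E J) W f \<eta> - avg (pair_weight E (J({v, u} := - J {v, u}))) W f \<eta>\<bar>
    \<le> tanh b * \<bar>avg (pair_weight E J) (W - {u}) f (\<eta>(u := 1))
                 - avg (pair_weight E J) (W - {u}) f (\<eta>(u := -1))\<bar>"
proof -
  have vu: "v \<noteq> u"
    using assms by auto
  let ?w = "pair_weight E J" and ?w' = "pair_weight E (J({v, u} := - J {v, u}))"
  let ?C = "\<lambda>s. configs (W - {u}) (\<eta>(u := s))" and ?s = "J {v, u}"
  have w': "?w' \<sigma> = ?w \<sigma> * exp (-2 * (?s * s))" if "\<sigma> \<in> ?C s" for \<sigma> s
    using that assms vu by (subst pair_weight_upd) (auto simp: configs_def)
  have S': "(\<Sum>\<sigma>\<in>?C s. ?w' \<sigma> * g \<sigma>) = (\<Sum>\<sigma>\<in>?C s. ?w \<sigma> * g \<sigma>) * exp (-2 * (?s * s))" for g s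
    unfolding sum_distrib_right by (intro sum.cong) (simp_all add: w')
  have pos: "(\<Sum>\<sigma>\<in>?C s. ?w \<sigma>) > 0" for s
    using assms by (intro sum_configs_pos) auto
  note * = mixture_diff_le[OF pos[of 1] pos[of "-1"] assms(7), where F = "\<Sum>\<sigma>\<in>?C 1. ?w \<sigma> * f \<sigma>"
      and G = "\<Sum>\<sigma>\<in>?C (-1). ?w \<sigma> * f \<sigma>"]
  show ?thesis
    using * S'[of f 1] S'[of f "-1"] S'[of "\<lambda>_. 1" 1] S'[of "\<lambda>_. 1" "-1"]
    unfolding avg_def configs_sum_split[OF assms(1,5)] by simp
qed

lemma pair_weight_spin_flip:
  assumes "\<And>e. e \<in> E \<Longrightarrow> finite e" "\<sigma> v = 1"
  shows "pair_weight E J (\<sigma>(v := -1)) = pair_weight E (\<lambda>e. if v \<in> e then - J e else J e) \<sigma>"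
proof -
  have "(\<Prod>x\<in>e. (\<sigma>(v := -1)) x) = (if v \<in> e then -1 else 1) * (\<Prod>x\<in>e. \<sigma> x)" if "e \<in> E" for e
  proof (cases "v \<in> e")
    case True
    have "(\<Prod>x\<in>e - {v}. (\<sigma>(v := -1)) x) = (\<Prod>x\<in>e - {v}. \<sigma> x)"
      by (intro prod.cong) auto
    with True assms(1)[OF that] assms(2) show ?thesis
      by (simp add: prod.remove)
  next
    case False
    then show ?thesis
      by (auto intro!: prod.cong)
  qed
  then show ?thesis
    by (auto simp: pair_weight_def intro!: sum.cong arg_cong[where f = exp])
qed

text \<open>The bijection that sets the spin at \<open>v\<close> to -1 moves the flip into the
  couplings at \<open>v\<close> and the observable. The pinned value then stays 1, and the flip can
  be carried out edge by edge.\<close>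

lemma avg_spin_flip:
  assumes "\<And>e. e \<in> E \<Longrightarrow> finite e" "v \<notin> W"
  shows "avg (pair_weight E J) W f (\<eta>(v := -1))
    = avg (pair_weight E (\<lambda>e. if v \<in> e then - J e else J e)) W (\<lambda>\<sigma>. f (\<sigma>(v := -1))) (\<eta>(v := 1))"
proof -
  have inj: "inj_on (\<lambda>\<sigma>. \<sigma>(v := -1)) (configs W (\<eta>(v := 1)))"
  proof (rule inj_onI)
    fix \<sigma> \<tau> assume *: "\<sigma> \<in> configs W (\<eta>(v := 1))" "\<tau> \<in> configs W (\<eta>(v := 1))"
      and "\<sigma>(v := -1) = \<tau>(v := -1)"
    then have "\<sigma>(v := 1) = \<tau>(v := 1)"
      by (metis fun_upd_upd)
    with * show "\<sigma> = \<tau>"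
      using assms(2) by (simp add: configs_def fun_upd_idem)
  qed
  have img: "configs W (\<eta>(v := -1)) = (\<lambda>\<sigma>. \<sigma>(v := -1)) ` configs W (\<eta>(v := 1))"
  proof (intro equalityI subsetI)
    fix \<sigma> assume "\<sigma> \<in> configs W (\<eta>(v := -1))"
    then have "\<sigma>(v := 1) \<in> configs W (\<eta>(v := 1))" "\<sigma> = (\<sigma>(v := 1))(v := -1)"
      using assms(2) by (auto simp: configs_def)
    then show "\<sigma> \<in> (\<lambda>\<sigma>. \<sigma>(v := -1)) ` configs W (\<eta>(v := 1))"
      by blast
  next
    fix \<sigma> assume "\<sigma> \<in> (\<lambda>\<sigma>. \<sigma>(v := -1)) ` configs W (\<eta>(v := 1))"
    then show "\<sigma> \<in> configs W (\<eta>(v := -1))"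
      using assms(2) unfolding configs_def by fastforce
  qed
  have "pair_weight E J (\<sigma>(v := -1)) = pair_weight E (\<lambda>e. if v \<in> e then - J e else J e) \<sigma>"
    if "\<sigma> \<in> configs W (\<eta>(v := 1))" for \<sigma>
    using that assms by (intro pair_weight_spin_flip) (auto simp: configs_def)
  then show ?thesis
    unfolding avg_def img by (simp add: sum.reindex[OF inj])
qed

subsection \<open>Influence of a pinned spin\<close>

lemma finite_graph_finite_edges: "finite_graph V E \<Longrightarrow> finite E"
  unfolding finite_graph_def by (rule finite_subset[of _ "Pow V"]) auto

lemma finite_graph_edge:
  assumes "finite_graph V E" "e \<in> E" "v \<in> e"
  obtains u where "e = {v, u}" "u \<noteq> v" "u \<in> V"
proof -
  have "e \<subseteq> V" "card e = 2"
    using assms by (auto simp: finite_graph_def)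
  with assms(3) that show ?thesis
    by (auto simp: card_2_iff)
qed

lemma flip_lipschitz_pin:
  assumes "flip_lipschitz V L f" "L \<ge> 0" "v \<in> V"
  shows "flip_lipschitz V L (\<lambda>\<sigma>. f (\<sigma>(v := -1)))"
  unfolding flip_lipschitz_def
proof (intro ballI)
  fix \<sigma> x assume \<sigma>: "\<sigma> \<in> spin_configs V" and x: "x \<in> V"
  show "\<bar>f (\<sigma>(x := 1, v := -1)) - f (\<sigma>(x := -1, v := -1))\<bar> \<le> L"
  proof (cases "x = v")
    case False
    then have "\<sigma>(x := 1, v := -1) = \<sigma>(v := -1, x := 1)" "\<sigma>(x := -1, v := -1) = \<sigma>(v := -1, x := -1)"
      by (simp_all add: fun_upd_twist)
    moreover have "\<sigma>(v := -1) \<in> spin_configs V"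
      using \<sigma> assms(3) by (intro spin_configs_upd) auto
    ultimately show ?thesis
      using assms(1) x by (simp add: flip_lipschitz_def)
  qed (use assms(2) in simp)
qed

text \<open>Induction on the number of free vertices, for all couplings bounded by
  \<open>\<beta>\<close> and all Lipschitz observables at once, since both change along the way. The
  summand 1 is the direct dependence of \<open>f\<close> on the spin at \<open>v\<close>; each edge
  from \<open>v\<close> to a free neighbour adds at most \<open>tanh \<beta>\<close> times the
  influence of that neighbour, which is at most \<open>L * D\<close>.\<close>

lemma avg_pinned_spin_lipschitz:
  fixes V :: "'a set" and E :: "'a set set" and d :: nat and \<beta> L :: real
  defines "D \<equiv> 1 / (1 - (real d - 1) * tanh \<beta>)"
  assumes graph: "finite_graph V E"
    and deg: "\<And>x. x \<in> V \<Longrightarrow> vertex_degree E x \<le> d"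
    and beta: "\<beta> \<ge> 0" "(real d - 1) * tanh \<beta> < 1" and L: "L \<ge> 0"
    and W: "W \<subseteq> V" and v: "v \<in> V - W" and \<eta>: "\<eta> \<in> spin_configs V"
    and J: "\<And>e. e \<in> E \<Longrightarrow> \<bar>J e\<bar> \<le> \<beta>" and f: "flip_lipschitz V L f"
  shows "\<bar>avg (pair_weight E J) W f (\<eta>(v := 1)) - avg (pair_weight E J) W f (\<eta>(v := -1))\<bar>
    \<le> L * (1 + card {e \<in> E. v \<in> e \<and> e \<subseteq> insert v W} * (tanh \<beta> * D))"
  using W v \<eta> J f
proof (induction "card W" arbitrary: W v \<eta> J f rule: less_induct)
  case (less W v \<eta> J f)
  define t where "t = tanh \<beta>"
  have t: "t \<ge> 0"
    using beta by (simp add: t_def)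
  \<comment> \<open>\<open>D\<close> is the fixed point of the recursion in which a vertex has
    \<open>d - 1\<close> free neighbours, so the induction reproduces the bound
    \<open>L * D\<close>.\<close>
  have D: "D > 0" "1 + (real d - 1) * t * D = D"
    using beta by (auto simp: D_def t_def field_simps)
  have finV: "finite V"
    using graph by (simp add: finite_graph_def)
  have finW: "finite W"
    using less.prems(1) finV by (rule finite_subset)
  have finE: "finite E"
    using graph by (rule finite_graph_finite_edges)
  have fine: "finite e" if "e \<in> E" for e
    using graph that by (auto simp: finite_graph_def intro: card_ge_0_finite)
  define g where "g = (\<lambda>\<sigma>. f (\<sigma>(v := -1)))"
  have g: "flip_lipschitz V L g"
    unfolding g_def using less.prems L by (intro flip_lipschitz_pin) auto
  have \<eta>1: "\<eta>(v := 1) \<in> spin_configs V"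
    using less.prems by (intro spin_configs_upd) auto
  let ?J = "\<lambda>S e. if e \<in> S then - J e else J e"
  let ?avg = "\<lambda>J W \<eta>. avg (pair_weight E J) W g \<eta>"
  \<comment> \<open>\<open>S\<close> collects the edges at \<open>v\<close> reversed so far.
    Reversing one more costs something only if its other end is free.\<close>
  have flip: "\<bar>?avg (?J S) W (\<eta>(v := 1)) - ?avg (?J (insert e S)) W (\<eta>(v := 1))\<bar> \<le>
      (if e \<subseteq> insert v W then 1 else 0) * (t * (L * D))"
    if S: "e \<in> E" "v \<in> e" "e \<notin> S" for e S
  proof -
    obtain u where u: "e = {v, u}" "u \<noteq> v" "u \<in> V"
      using finite_graph_edge[OF graph S(1,2)] .
    have upd: "?J (insert e S) = (?J S)(e := - ?J S e)"
      using S(3) by auto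
    show ?thesis
    proof (cases "u \<in> W")
      case True
      have smaller: "card (W - {u}) < card W"
        using True finW by (intro psubset_card_mono) auto
      let ?n = "real (card {e' \<in> E. u \<in> e' \<and> e' \<subseteq> insert u (W - {u})})"
      \<comment> \<open>The edge back to the pinned vertex \<open>v\<close> is lost for
        \<open>u\<close>. This is what replaces \<open>d\<close> by \<open>d - 1\<close> in the
        recursion.\<close>
      have "e \<in> {e' \<in> E. u \<in> e'} - {e' \<in> E. u \<in> e' \<and> e' \<subseteq> insert u (W - {u})}"
        using S u less.prems by simp
      then have "{e' \<in> E. u \<in> e' \<and> e' \<subseteq> insert u (W - {u})} \<subset> {e' \<in> E. u \<in> e'}"
        by blast
      then have "card {e' \<in> E. u \<in> e' \<and> e' \<subseteq> insert u (W - {u})} < card {e' \<in> E. u \<in> e'}"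
        using finE by (intro psubset_card_mono) auto
      with deg[OF u(3)] have "?n \<le> real d - 1"
        by (simp add: vertex_degree_def)
      then have "L * (1 + ?n * (t * D)) \<le> L * (1 + (real d - 1) * (t * D))"
        using L t D by (intro mult_left_mono add_left_mono mult_right_mono) auto
      moreover have "L * (1 + (real d - 1) * (t * D)) = L * D"
        using D(2) by (simp add: mult.assoc)
      moreover have "\<bar>?avg (?J S) (W - {u}) (\<eta>(v := 1, u := 1)) - ?avg (?J S) (W - {u}) (\<eta>(v := 1, u := -1))\<bar>
          \<le> L * (1 + ?n * (t * D))"
        unfolding t_def
        by (rule less.hyps[OF smaller]) (use less.prems u g \<eta>1 in auto)
      ultimately have "t * \<bar>?avg (?J S) (W - {u}) (\<eta>(v := 1, u := 1)) - ?avg (?J S) (W - {u}) (\<eta>(v := 1, u := -1))\<bar>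
          \<le> t * (L * D)"
        using t by (intro mult_left_mono) linarith+
      moreover have "\<bar>?avg (?J S) W (\<eta>(v := 1)) - ?avg (?J (insert e S)) W (\<eta>(v := 1))\<bar> \<le>
          t * \<bar>?avg (?J S) (W - {u}) (\<eta>(v := 1, u := 1)) - ?avg (?J S) (W - {u}) (\<eta>(v := 1, u := -1))\<bar>"
        unfolding upd unfolding u(1) t_def
        by (rule avg_edge_flip_le[OF finW finE])
           (use S u True less.prems in auto)
      moreover have "e \<subseteq> insert v W"
        using True u by simp
      ultimately show ?thesis
        by simp
    next
      case False
      then have "e \<inter> W = {}"
        using u less.prems by auto
      then have "?avg (?J (insert e S)) W (\<eta>(v := 1)) = ?avg (?J S) W (\<eta>(v := 1))"
        unfolding upd by (rule avg_edge_flip_pinned[OF finE S(1)])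
      then show ?thesis
        using t L D by simp
    qed
  qed
  \<comment> \<open>Telescoping over the reversed edges; below, \<open>S\<close> becomes the set of
    all edges at \<open>v\<close>.\<close>
  have "\<bar>?avg J W (\<eta>(v := 1)) - ?avg (?J S) W (\<eta>(v := 1))\<bar> \<le>
      card {e \<in> S. e \<subseteq> insert v W} * (t * (L * D))"
    if "S \<subseteq> {e \<in> E. v \<in> e}" "finite S" for S
    using that(2,1)
  proof (induction S rule: finite_induct)
    case (insert e S)
    have "{e' \<in> insert e S. e' \<subseteq> insert v W}
        = (if e \<subseteq> insert v W then insert e {e' \<in> S. e' \<subseteq> insert v W} else {e' \<in> S. e' \<subseteq> insert v W})"
      by auto
    then have "real (card {e' \<in> insert e S. e' \<subseteq> insert v W}) =
        (if e \<subseteq> insert v W then 1 else 0) + real (card {e' \<in> S. e' \<subseteq> insert v W})"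
      using insert by auto
    moreover have "\<bar>?avg J W (\<eta>(v := 1)) - ?avg (?J S) W (\<eta>(v := 1))\<bar>
        \<le> card {e \<in> S. e \<subseteq> insert v W} * (t * (L * D))"
      by (rule insert.IH) (use insert.prems in auto)
    moreover have "\<bar>?avg (?J S) W (\<eta>(v := 1)) - ?avg (?J (insert e S)) W (\<eta>(v := 1))\<bar> \<le>
      (if e \<subseteq> insert v W then 1 else 0) * (t * (L * D))"
      using insert by (intro flip) auto
    ultimately show ?case
      by (simp only: distrib_right)
  qed simp
  note this[of "{e \<in> E. v \<in> e}"]
  moreover have "{e \<in> {e \<in> E. v \<in> e}. e \<subseteq> insert v W} = {e \<in> E. v \<in> e \<and> e \<subseteq> insert v W}"
    by auto
  moreover have "pair_weight E (?J {e \<in> E. v \<in> e}) = pair_weight E (\<lambda>e. if v \<in> e then - J e else J e)"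
    by (rule ext) (auto simp: pair_weight_def intro!: sum.cong arg_cong[where f = exp])
  moreover have "avg (pair_weight E J) W f (\<eta>(v := -1))
      = avg (pair_weight E (\<lambda>e. if v \<in> e then - J e else J e)) W g (\<eta>(v := 1))"
    unfolding g_def using fine less.prems by (intro avg_spin_flip) auto
  ultimately have "\<bar>?avg J W (\<eta>(v := 1)) - avg (pair_weight E J) W f (\<eta>(v := -1))\<bar>
      \<le> card {e \<in> E. v \<in> e \<and> e \<subseteq> insert v W} * (t * (L * D))"
    using finE by simp
  \<comment> \<open>Under the same law, replacing \<open>f\<close> by \<open>g\<close> amounts to a
    single spin flip at \<open>v\<close> inside the observable.\<close>
  moreover have "\<bar>avg (pair_weight E J) W f (\<eta>(v := 1)) - ?avg J W (\<eta>(v := 1))\<bar> \<le> L"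
  proof (rule avg_diff_le[OF finW])
    fix \<sigma> assume \<sigma>: "\<sigma> \<in> configs W (\<eta>(v := 1))"
    then have "\<sigma> \<in> spin_configs V" "\<sigma>(v := 1) = \<sigma>"
      using configs_subset_spin_configs[OF less.prems(1) \<eta>1] less.prems(2)
      by (auto simp: configs_def)
    then show "\<bar>f \<sigma> - g \<sigma>\<bar> \<le> L"
      using less.prems by (auto simp: flip_lipschitz_def g_def dest!: bspec[of _ _ \<sigma>])
  qed simp
  ultimately show ?case
    by (simp add: t_def algebra_simps)
qed

text \<open>If \<open>x\<close> is pinned, all of its at most \<open>d\<close> edges may lead to
  free vertices, hence the factor \<open>d\<close> at the root. If \<open>x\<close> is free, its
  value in the boundary condition is never read.\<close>

lemma avg_lipschitz:
  assumes graph: "finite_graph V E"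
    and deg: "\<And>x. x \<in> V \<Longrightarrow> vertex_degree E x \<le> d"
    and beta: "\<beta> \<ge> 0" "(real d - 1) * tanh \<beta> < 1" and L: "L \<ge> 0"
    and f: "flip_lipschitz V L f" and \<sigma>: "\<sigma> \<in> spin_configs V" and x: "x \<in> V"
  shows "\<bar>avg (ising_weight E \<beta>) (V - A) f (\<sigma>(x := 1)) - avg (ising_weight E \<beta>) (V - A) f (\<sigma>(x := -1))\<bar>
    \<le> (if x \<in> A then L * (1 + d * tanh \<beta> / (1 - (real d - 1) * tanh \<beta>)) else 0)"
proof (cases "x \<in> A")
  case True
  have ising: "ising_weight E \<beta> = pair_weight E (\<lambda>_. \<beta>)"
    by (auto simp: ising_weight_def pair_weight_def sum_distrib_left)
  let ?n = "real (card {e \<in> E. x \<in> e \<and> e \<subseteq> insert x (V - A)})"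
  have "card {e \<in> E. x \<in> e \<and> e \<subseteq> insert x (V - A)} \<le> card {e \<in> E. x \<in> e}"
    using finite_graph_finite_edges[OF graph] by (intro card_mono) auto
  also have "\<dots> \<le> d"
    using deg[OF x] by (simp add: vertex_degree_def)
  finally have "?n \<le> real d"
    by simp
  then have "L * (1 + ?n * (tanh \<beta> * (1 / (1 - (real d - 1) * tanh \<beta>))))
      \<le> L * (1 + real d * (tanh \<beta> * (1 / (1 - (real d - 1) * tanh \<beta>))))"
    using L beta by (intro mult_left_mono add_left_mono mult_right_mono) auto
  moreover have "\<bar>avg (ising_weight E \<beta>) (V - A) f (\<sigma>(x := 1)) - avg (ising_weight E \<beta>) (V - A) f (\<sigma>(x := -1))\<bar>
    \<le> L * (1 + ?n * (tanh \<beta> * (1 / (1 - (real d - 1) * tanh \<beta>))))"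
    unfolding ising
    by (rule avg_pinned_spin_lipschitz[OF graph deg]) (use True assms in auto)
  ultimately show ?thesis
    using True by simp
next
  case False
  with x have "configs (V - A) (\<sigma>(x := 1)) = configs (V - A) (\<sigma>(x := -1))"
    by (intro configs_cong) auto
  with False show ?thesis
    by (simp add: avg_def)
qed

text \<open>Prepares the spectral bound. Log-convexity makes the successive ratios nondecreasing, so
  the sequence grows at least like powers of its first ratio \<open>r\<close>. If \<open>r\<close>
  exceeded \<open>\<rho>\<close>, this would contradict the upper bound for large
  \<open>k\<close>.\<close>

lemma log_convex_growth_bound:
  fixes B :: "nat \<Rightarrow> real"
  assumes nonneg: "\<And>k. B k \<ge> 0" and log_convex: "\<And>k. (B (Suc k))\<^sup>2 \<le> B k * B (Suc (Suc k))"
    and growth: "\<And>k. B k \<le> K * \<rho> ^ k" and \<rho>: "\<rho> \<ge> 0"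
  shows "B 1 \<le> \<rho> * B 0"
proof (rule ccontr)
  assume "\<not> B 1 \<le> \<rho> * B 0"
  then have less: "\<rho> * B 0 < B 1"
    by simp
  have B0: "B 0 > 0"
  proof (rule ccontr)
    assume "\<not> B 0 > 0"
    with nonneg[of 0] have "B 0 = 0"
      by simp
    with log_convex[of 0] less show False
      by simp
  qed
  define r where "r = B 1 / B 0"
  have r: "r > \<rho>"
    using less B0 by (simp add: r_def field_simps)
  have step: "B (Suc k) \<ge> r * B k" for k
  proof (induction k)
    case (Suc k)
    show ?case
    proof (cases "B (Suc k) = 0")
      case False
      then have pos: "B (Suc k) > 0"
        using nonneg[of "Suc k"] by simp
      then have "B k * B (Suc (Suc k)) > 0"
        using log_convex[of k] by (smt (verit) zero_less_power)
      then have "B k > 0"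
        using nonneg[of k] by (smt (verit) mult_eq_0_iff)
      have "B k * (r * B (Suc k)) = (r * B k) * B (Suc k)"
        by simp
      also have "\<dots> \<le> B (Suc k) * B (Suc k)"
        using Suc pos by (intro mult_right_mono) auto
      also have "\<dots> \<le> B k * B (Suc (Suc k))"
        using log_convex[of k] by (simp add: power2_eq_square)
      finally show ?thesis
        using \<open>B k > 0\<close> by simp
    qed (use nonneg in simp)
  qed (use B0 in \<open>simp add: r_def\<close>)
  have lower: "B k \<ge> r ^ k * B 0" for k
  proof (induction k)
    case (Suc k)
    then have "r * (r ^ k * B 0) \<le> r * B k"
      using r \<rho> by (intro mult_left_mono) auto
    with step[of k] show ?case
      by simp
  qed simp
  \<comment> \<open>Combine both bounds and divide by the power of \<open>r\<close>; as
    \<open>r > \<rho>\<close>, the right-hand side tends to 0 although \<open>B 0\<close> is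
    positive.\<close>
  have "B 0 \<le> K * (\<rho> / r) ^ k" for k
    using order_trans[OF lower[of k] growth[of k]] r \<rho> by (simp add: field_simps power_divide)
  moreover have "(\<lambda>k. K * (\<rho> / r) ^ k) \<longlonglongrightarrow> K * 0"
    by (intro tendsto_mult tendsto_const LIMSEQ_power_zero) (use r \<rho> in auto)
  ultimately have "B 0 \<le> K * 0"
    by (intro LIMSEQ_le_const) auto
  with B0 show False
    by simp
qed

text \<open>The values of \<open>\<tau>\<close> are copied into \<open>\<sigma>\<close> one vertex
  at a time, and each copy costs at most \<open>L\<close>.\<close>

lemma flip_lipschitz_diff:
  assumes "finite V" "flip_lipschitz V L f" "\<sigma> \<in> spin_configs V" "\<tau> \<in> spin_configs V"
  shows "\<bar>f \<sigma> - f \<tau>\<bar> \<le> L * card V"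
proof -
  have "\<bar>f \<sigma> - f (override_on \<sigma> \<tau> W)\<bar> \<le> L * card W \<and> override_on \<sigma> \<tau> W \<in> spin_configs V"
    if "finite W" "W \<subseteq> V" for W
    using that
  proof (induction W rule: finite_induct)
    case empty
    with assms show ?case
      by simp
  next
    case (insert x W)
    define \<rho> where "\<rho> = override_on \<sigma> \<tau> W"
    have \<rho>: "\<rho> \<in> spin_configs V" "\<bar>f \<sigma> - f \<rho>\<bar> \<le> L * card W" and x: "x \<in> V"
      using insert by (auto simp: \<rho>_def)
    have ov: "override_on \<sigma> \<tau> (insert x W) = \<rho>(x := \<tau> x)"
      by (auto simp: \<rho>_def override_on_def)
    have "\<rho> x \<in> {-1, 1}" "\<tau> x \<in> {-1, 1}"
      using \<rho>(1) assms(4) x by (auto simp: mem_spin_configs_iff)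
    moreover have "\<bar>f (\<rho>(x := 1)) - f (\<rho>(x := -1))\<bar> \<le> L"
      using assms(2) \<rho> x by (auto simp: flip_lipschitz_def)
    moreover have "\<bar>f (\<rho>(x := a)) - f (\<rho>(x := b))\<bar> \<le> L"
      if "\<bar>f (\<rho>(x := 1)) - f (\<rho>(x := -1))\<bar> \<le> L" "a \<in> {-1, 1}" "b \<in> {-1, 1}" for a b
      using that by (elim insertE emptyE) (simp_all add: abs_minus_commute)
    ultimately have "\<bar>f (\<rho>(x := \<rho> x)) - f (\<rho>(x := \<tau> x))\<bar> \<le> L"
      by blast
    then have "\<bar>f \<rho> - f (\<rho>(x := \<tau> x))\<bar> \<le> L"
      by simp
    with \<rho>(2) have "\<bar>f \<sigma> - f (\<rho>(x := \<tau> x))\<bar> \<le> L * card (insert x W)"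
      using insert by (simp add: algebra_simps)
    moreover have "\<rho>(x := \<tau> x) \<in> spin_configs V"
      using \<rho>(1) x \<open>\<tau> x \<in> {-1, 1}\<close> by (intro spin_configs_upd)
    ultimately show ?case
      unfolding ov by blast
  qed
  from this[OF assms(1) order_refl] have "\<bar>f \<sigma> - f (override_on \<sigma> \<tau> V)\<bar> \<le> L * card V"
    by blast
  moreover have "override_on \<sigma> \<tau> V = \<tau>"
    using assms(3,4) by (auto simp: override_on_def mem_spin_configs_iff)
  ultimately show ?thesis
    by simp
qed

subsection \<open>Spectral bound for the averaged conditional expectation\<close>

locale spin_weight =
  fixes V :: "'a set" and w :: "('a \<Rightarrow> real) \<Rightarrow> real"
  assumes finite_V: "finite V" and weight_pos: "\<And>\<sigma>. w \<sigma> > 0"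
begin

abbreviation "\<Omega> \<equiv> spin_configs V"

text \<open>The inner product is left unnormalised; the total weight cancels in the ratio defining
  the clue.\<close>

definition ip :: "(('a \<Rightarrow> real) \<Rightarrow> real) \<Rightarrow> (('a \<Rightarrow> real) \<Rightarrow> real) \<Rightarrow> real" where
  "ip f g = (\<Sum>\<sigma>\<in>\<Omega>. w \<sigma> * f \<sigma> * g \<sigma>)"

text \<open>Conditioning on the spins in \<open>A\<close> means averaging over the free set
  \<open>V - A\<close>.\<close>

definition cond :: "'a set \<Rightarrow> (('a \<Rightarrow> real) \<Rightarrow> real) \<Rightarrow> ('a \<Rightarrow> real) \<Rightarrow> real" where
  "cond A f = avg w (V - A) f"

lemma finite_\<Omega>: "finite \<Omega>"
  by (rule finite_spin_configs[OF finite_V])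

lemma ip_commute: "ip f g = ip g f"
  by (simp add: ip_def mult_ac)

lemma ip_cong: "(\<And>\<sigma>. \<sigma> \<in> \<Omega> \<Longrightarrow> f \<sigma> = f' \<sigma>) \<Longrightarrow> (\<And>\<sigma>. \<sigma> \<in> \<Omega> \<Longrightarrow> g \<sigma> = g' \<sigma>) \<Longrightarrow> ip f g = ip f' g'"
  by (simp add: ip_def)

lemma ip_nonneg: "ip f f \<ge> 0"
  unfolding ip_def by (intro sum_nonneg) (simp add: mult.assoc less_imp_le[OF weight_pos])

lemma ip_Cauchy_Schwarz: "(ip f g)\<^sup>2 \<le> ip f f * ip g g"
proof -
  have "(\<Sum>\<sigma>\<in>\<Omega>. (sqrt (w \<sigma>) * f \<sigma>) * (sqrt (w \<sigma>) * g \<sigma>))\<^sup>2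
      \<le> (\<Sum>\<sigma>\<in>\<Omega>. (sqrt (w \<sigma>) * f \<sigma>)\<^sup>2) * (\<Sum>\<sigma>\<in>\<Omega>. (sqrt (w \<sigma>) * g \<sigma>)\<^sup>2)"
    by (rule Cauchy_Schwarz_ineq_sum)
  moreover have "sqrt (w \<sigma>) * x * (sqrt (w \<sigma>) * y) = w \<sigma> * x * y" for \<sigma> x y
  proof -
    have "sqrt (w \<sigma>) * x * (sqrt (w \<sigma>) * y) = (sqrt (w \<sigma>) * sqrt (w \<sigma>)) * x * y"
      by (simp only: mult_ac)
    then show ?thesis
      using weight_pos[of \<sigma>] by simp
  qed
  ultimately show ?thesis
    by (simp add: ip_def power2_eq_square)
qed

lemma mem_configs_complement:
  assumes "\<sigma> \<in> \<Omega>"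
  shows "\<tau> \<in> configs (V - A) \<sigma> \<longleftrightarrow> \<tau> \<in> \<Omega> \<and> (\<forall>x\<in>A. \<tau> x = \<sigma> x)"
proof (intro iffI conjI ballI)
  assume \<tau>: "\<tau> \<in> configs (V - A) \<sigma>"
  then show "\<tau> \<in> \<Omega>"
    using configs_subset_spin_configs[of "V - A" V \<sigma>] assms by auto
  show "\<tau> x = \<sigma> x" if "x \<in> A" for x
    using \<tau> that by (auto simp: configs_def)
next
  assume "\<tau> \<in> \<Omega> \<and> (\<forall>x\<in>A. \<tau> x = \<sigma> x)"
  with assms show "\<tau> \<in> configs (V - A) \<sigma>"
    by (auto simp: configs_def mem_spin_configs_iff)
qed

lemma cond_cong:
  assumes "\<sigma> \<in> \<Omega>" "\<tau> \<in> \<Omega>" "\<And>x. x \<in> A \<Longrightarrow> \<sigma> x = \<tau> x"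
  shows "cond A f \<sigma> = cond A f \<tau>"
proof -
  have "configs (V - A) \<sigma> = configs (V - A) \<tau>"
    using assms by (intro configs_cong) (auto simp: mem_spin_configs_iff)
  then show ?thesis
    by (simp add: cond_def avg_def)
qed

text \<open>Functions of the spins in \<open>A\<close> are fixed by \<open>cond A\<close>. This
  yields idempotence, preservation of the mean and, later, the defining property of conditional
  expectations.\<close>

lemma cond_eqI:
  assumes "\<sigma> \<in> \<Omega>" "\<And>\<tau>. \<tau> \<in> \<Omega> \<Longrightarrow> (\<And>x. x \<in> A \<Longrightarrow> \<tau> x = \<sigma> x) \<Longrightarrow> f \<tau> = c"
  shows "cond A f \<sigma> = c"
proof -
  have "(\<Sum>\<tau>\<in>configs (V - A) \<sigma>. w \<tau> * f \<tau>) = (\<Sum>\<tau>\<in>configs (V - A) \<sigma>. w \<tau> * c)"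
    using assms by (intro sum.cong) (auto simp: mem_configs_complement)
  moreover have "(\<Sum>\<tau>\<in>configs (V - A) \<sigma>. w \<tau>) > 0"
    using finite_V by (intro sum_configs_pos weight_pos) auto
  ultimately show ?thesis
    by (simp add: cond_def avg_def flip: sum_distrib_right)
qed

text \<open>Written as a double sum, \<open>cond A\<close> has the kernel
  \<open>w \<sigma> * w \<tau> / ?Z \<sigma>\<close> on pairs that agree on \<open>A\<close>. It is
  symmetric because \<open>?Z\<close> takes the same value at both members of such a pair.\<close>

lemma ip_cond: "ip (cond A f) g = ip f (cond A g)"
proof -
  let ?Z = "\<lambda>\<sigma>. \<Sum>\<tau>\<in>configs (V - A) \<sigma>. w \<tau>"
  let ?r = "\<lambda>\<sigma> \<tau>. \<forall>x\<in>A. \<tau> x = \<sigma> x"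
  have cond_eq: "cond A f \<sigma> = (\<Sum>\<tau>\<in>\<Omega>. if ?r \<sigma> \<tau> then w \<tau> * f \<tau> / ?Z \<sigma> else 0)" if "\<sigma> \<in> \<Omega>" for f \<sigma>
  proof -
    have "configs (V - A) \<sigma> = {\<tau> \<in> \<Omega>. ?r \<sigma> \<tau>}"
      using mem_configs_complement[OF that] by auto
    then have "(\<Sum>\<tau>\<in>configs (V - A) \<sigma>. w \<tau> * f \<tau> / c) = (\<Sum>\<tau>\<in>\<Omega>. if ?r \<sigma> \<tau> then w \<tau> * f \<tau> / c else 0)" for c
      by (simp add: sum.inter_filter[OF finite_\<Omega>])
    then show ?thesis
      by (simp add: cond_def avg_def sum_divide_distrib)
  qed
  have Z: "?Z \<sigma> = ?Z \<tau>" if "\<sigma> \<in> \<Omega>" "\<tau> \<in> \<Omega>" "?r \<sigma> \<tau>" for \<sigma> \<tau>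
    using that by (intro sum.cong configs_cong) (auto simp: mem_spin_configs_iff)
  have "ip (cond A f) g = (\<Sum>\<sigma>\<in>\<Omega>. \<Sum>\<tau>\<in>\<Omega>. if ?r \<sigma> \<tau> then w \<sigma> * w \<tau> * f \<tau> * g \<sigma> / ?Z \<sigma> else 0)"
  proof (unfold ip_def, rule sum.cong[OF refl])
    fix \<sigma> assume "\<sigma> \<in> \<Omega>"
    then show "w \<sigma> * cond A f \<sigma> * g \<sigma>
        = (\<Sum>\<tau>\<in>\<Omega>. if ?r \<sigma> \<tau> then w \<sigma> * w \<tau> * f \<tau> * g \<sigma> / ?Z \<sigma> else 0)"
      unfolding cond_eq[OF \<open>\<sigma> \<in> \<Omega>\<close>] sum_distrib_left sum_distrib_right by (intro sum.cong) auto
  qed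
  also have "\<dots> = (\<Sum>\<tau>\<in>\<Omega>. \<Sum>\<sigma>\<in>\<Omega>. if ?r \<sigma> \<tau> then w \<sigma> * w \<tau> * f \<tau> * g \<sigma> / ?Z \<sigma> else 0)"
    by (rule sum.swap)
  also have "\<dots> = (\<Sum>\<tau>\<in>\<Omega>. \<Sum>\<sigma>\<in>\<Omega>. if ?r \<tau> \<sigma> then w \<sigma> * w \<tau> * f \<tau> * g \<sigma> / ?Z \<tau> else 0)"
  proof (intro sum.cong refl)
    fix \<sigma> \<tau> assume *: "\<sigma> \<in> \<Omega>" "\<tau> \<in> \<Omega>"
    show "(if ?r \<sigma> \<tau> then w \<sigma> * w \<tau> * f \<tau> * g \<sigma> / ?Z \<sigma> else 0)
        = (if ?r \<tau> \<sigma> then w \<sigma> * w \<tau> * f \<tau> * g \<sigma> / ?Z \<tau> else 0)"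
    proof (cases "?r \<sigma> \<tau>")
      case True
      then have "?r \<tau> \<sigma>"
        by simp
      show ?thesis
        unfolding if_P[OF True] if_P[OF \<open>?r \<tau> \<sigma>\<close>] Z[OF * True] ..
    qed auto
  qed
  also have "\<dots> = ip f (cond A g)"
  proof (unfold ip_def, rule sum.cong[OF refl])
    fix \<tau> assume "\<tau> \<in> \<Omega>"
    then show "(\<Sum>\<sigma>\<in>\<Omega>. if ?r \<tau> \<sigma> then w \<sigma> * w \<tau> * f \<tau> * g \<sigma> / ?Z \<tau> else 0)
        = w \<tau> * f \<tau> * cond A g \<tau>"
      unfolding cond_eq[OF \<open>\<tau> \<in> \<Omega>\<close>] sum_distrib_left sum_distrib_right by (intro sum.cong) auto
  qed
  finally show ?thesis .
qed

text \<open>\<open>cond A\<close> is idempotent and self-adjoint, hence an orthogonal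
  projection.\<close>

lemma ip_cond_cond: "ip (cond A f) (cond A f) = ip f (cond A f)"
proof -
  have idem: "cond A (cond A f) \<sigma> = cond A f \<sigma>" if "\<sigma> \<in> \<Omega>" for \<sigma>
    by (rule cond_eqI[OF that], rule cond_cong) (use that in auto)
  have "ip (cond A f) (cond A f) = ip f (cond A (cond A f))"
    by (rule ip_cond)
  also have "\<dots> = ip f (cond A f)"
    by (rule ip_cong) (simp_all add: idem)
  finally show ?thesis .
qed

text \<open>This is the operator \<open>T\<close> of the overview when \<open>p\<close>, the law of
  the random set, is supported on subsets of \<open>V\<close>.\<close>

definition resample :: "'a set pmf \<Rightarrow> (('a \<Rightarrow> real) \<Rightarrow> real) \<Rightarrow> ('a \<Rightarrow> real) \<Rightarrow> real" where
  "resample p f \<sigma> = (\<Sum>A\<in>Pow V. pmf p A * cond A f \<sigma>)"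

lemma ip_resample_left: "ip (resample p f) g = (\<Sum>A\<in>Pow V. pmf p A * ip (cond A f) g)"
proof -
  have "ip (resample p f) g = (\<Sum>\<sigma>\<in>\<Omega>. \<Sum>A\<in>Pow V. pmf p A * (w \<sigma> * cond A f \<sigma> * g \<sigma>))"
    unfolding ip_def resample_def sum_distrib_left sum_distrib_right
    by (intro sum.cong refl) (simp only: mult_ac)
  also have "\<dots> = (\<Sum>A\<in>Pow V. \<Sum>\<sigma>\<in>\<Omega>. pmf p A * (w \<sigma> * cond A f \<sigma> * g \<sigma>))"
    by (rule sum.swap)
  also have "\<dots> = (\<Sum>A\<in>Pow V. pmf p A * ip (cond A f) g)"
    by (simp only: ip_def sum_distrib_left)
  finally show ?thesis .
qed

lemma ip_resample: "ip (resample p f) g = ip f (resample p g)"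
proof -
  have "ip (resample p f) g = (\<Sum>A\<in>Pow V. pmf p A * ip (cond A g) f)"
    unfolding ip_resample_left by (intro sum.cong refl) (metis ip_cond ip_commute)
  also have "\<dots> = ip f (resample p g)"
    by (metis ip_resample_left ip_commute)
  finally show ?thesis .
qed

lemma ip_cond_one: "ip (cond A f) (\<lambda>_. 1) = ip f (\<lambda>_. 1)"
  unfolding ip_cond by (intro ip_cong refl cond_eqI)

lemma ip_resample_one:
  assumes "ip f (\<lambda>_. 1) = 0"
  shows "ip (resample p f) (\<lambda>_. 1) = 0"
  by (simp add: ip_resample_left ip_cond_one assms)

lemma total_weight_pos: "(\<Sum>\<sigma>\<in>\<Omega>. w \<sigma>) > 0"
  by (intro sum_pos finite_\<Omega> spin_configs_nonempty weight_pos)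

text \<open>A centred function is bounded by its oscillation, which is at most
  \<open>L * card V\<close>. The constant may be crude, as only exponential rates matter
  later.\<close>

lemma ip_le_lipschitz:
  assumes mean: "ip f (\<lambda>_. 1) = 0" and f: "flip_lipschitz V L f"
  shows "ip f f \<le> (\<Sum>\<sigma>\<in>\<Omega>. w \<sigma>) * (L * card V)\<^sup>2"
proof -
  let ?Z = "\<Sum>\<sigma>\<in>\<Omega>. w \<sigma>"
  have bound: "\<bar>f \<sigma>\<bar> \<le> L * card V" if \<sigma>: "\<sigma> \<in> \<Omega>" for \<sigma>
  proof -
    \<comment> \<open>As \<open>f\<close> has mean zero, subtracting its weighted sum changes
      nothing.\<close>
    have "?Z * f \<sigma> = (\<Sum>\<tau>\<in>\<Omega>. w \<tau> * (f \<sigma> - f \<tau>))"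
      using mean by (simp add: ip_def right_diff_distrib sum_subtractf sum_distrib_right)
    then have "?Z * \<bar>f \<sigma>\<bar> = \<bar>\<Sum>\<tau>\<in>\<Omega>. w \<tau> * (f \<sigma> - f \<tau>)\<bar>"
      using total_weight_pos by (metis abs_mult abs_of_pos)
    also have "\<dots> \<le> (\<Sum>\<tau>\<in>\<Omega>. w \<tau> * (L * card V))"
    proof (intro order_trans[OF sum_abs] sum_mono)
      fix \<tau> assume "\<tau> \<in> \<Omega>"
      then show "\<bar>w \<tau> * (f \<sigma> - f \<tau>)\<bar> \<le> w \<tau> * (L * card V)"
        using flip_lipschitz_diff[OF finite_V f \<sigma>] weight_pos[of \<tau>]
        by (simp add: abs_mult mult_left_mono)
    qed
    also have "\<dots> = ?Z * (L * card V)"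
      by (simp only: sum_distrib_right)
    finally show ?thesis
      using total_weight_pos by (simp only: mult_le_cancel_left_pos)
  qed
  have "ip f f \<le> (\<Sum>\<sigma>\<in>\<Omega>. w \<sigma> * (L * card V)\<^sup>2)"
    unfolding ip_def
  proof (intro sum_mono)
    fix \<sigma> assume "\<sigma> \<in> \<Omega>"
    then have "\<bar>f \<sigma>\<bar>\<^sup>2 \<le> (L * card V)\<^sup>2"
      by (intro power_mono bound) auto
    then have "(f \<sigma>)\<^sup>2 \<le> (L * card V)\<^sup>2"
      by simp
    then show "w \<sigma> * f \<sigma> * f \<sigma> \<le> w \<sigma> * (L * card V)\<^sup>2"
      using weight_pos[of \<sigma>] by (simp only: mult.assoc flip: power2_eq_square) (simp only: mult_left_mono less_imp_le)
  qed
  then show ?thesis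
    by (simp only: sum_distrib_right)
qed

lemma ex_flip_lipschitz: "\<exists>L\<ge>0. flip_lipschitz V L f"
proof (intro exI conjI)
  have le: "\<bar>f \<sigma>\<bar> \<le> (\<Sum>\<tau>\<in>\<Omega>. \<bar>f \<tau>\<bar>)" if "\<sigma> \<in> \<Omega>" for \<sigma>
    using that by (intro member_le_sum[of \<sigma> \<Omega> "\<lambda>\<tau>. \<bar>f \<tau>\<bar>"] finite_\<Omega>) auto
  show "flip_lipschitz V (2 * (\<Sum>\<tau>\<in>\<Omega>. \<bar>f \<tau>\<bar>)) f"
    unfolding flip_lipschitz_def
  proof (intro ballI)
    fix \<sigma> x assume "\<sigma> \<in> \<Omega>" "x \<in> V"
    then have "\<bar>f (\<sigma>(x := 1))\<bar> \<le> (\<Sum>\<tau>\<in>\<Omega>. \<bar>f \<tau>\<bar>)" "\<bar>f (\<sigma>(x := -1))\<bar> \<le> (\<Sum>\<tau>\<in>\<Omega>. \<bar>f \<tau>\<bar>)"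
      by (intro le spin_configs_upd; simp)+
    then show "\<bar>f (\<sigma>(x := 1)) - f (\<sigma>(x := -1))\<bar> \<le> 2 * (\<Sum>\<tau>\<in>\<Omega>. \<bar>f \<tau>\<bar>)"
      by linarith
  qed
qed (simp add: sum_nonneg)

text \<open>Let \<open>B k\<close> be the squared norm of the \<open>k\<close>-th iterate.
  Contraction of Lipschitz constants gives decay at rate \<open>\<kappa>\<^sup>2\<close>, with a
  prefactor depending on \<open>f\<close> and \<open>V\<close>. Log-convexity transfers the rate to
  the first step and discards the prefactor.\<close>

lemma ip_resample_le:
  assumes \<kappa>: "\<kappa> \<ge> 0"
    and contraction: "\<And>L f. L \<ge> 0 \<Longrightarrow> flip_lipschitz V L f \<Longrightarrow> flip_lipschitz V (\<kappa> * L) (resample p f)"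
    and mean: "ip f (\<lambda>_. 1) = 0"
  shows "ip f (resample p f) \<le> \<kappa> * ip f f"
proof -
  obtain L where L: "L \<ge> 0" "flip_lipschitz V L f"
    using ex_flip_lipschitz by blast
  define F where "F k = (resample p ^^ k) f" for k
  have F_Suc: "F (Suc k) = resample p (F k)" for k
    by (simp add: F_def)
  define B where "B k = ip (F k) (F k)" for k
  have F_lipschitz: "flip_lipschitz V (\<kappa> ^ k * L) (F k)" for k
  proof (induction k)
    case (Suc k)
    then show ?case
      using contraction[of "\<kappa> ^ k * L" "F k"] L \<kappa> by (simp add: F_Suc mult.assoc)
  qed (use L in \<open>simp add: F_def\<close>)
  have F_mean: "ip (F k) (\<lambda>_. 1) = 0" for k
  proof (induction k)
    case (Suc k)
    then show ?case
      by (simp add: F_Suc ip_resample_one)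
  qed (use mean in \<open>simp add: F_def\<close>)
  have "B 1 \<le> \<kappa>\<^sup>2 * B 0"
  proof (rule log_convex_growth_bound)
    show "B k \<ge> 0" for k
      by (simp add: B_def ip_nonneg)
    show "(B (Suc k))\<^sup>2 \<le> B k * B (Suc (Suc k))" for k
    proof -
      \<comment> \<open>Self-adjointness moves one application of \<open>resample p\<close> to the
        other argument; Cauchy-Schwarz then gives log-convexity.\<close>
      have "B (Suc k) = ip (F k) (F (Suc (Suc k)))"
        by (simp only: B_def F_Suc ip_resample)
      then show ?thesis
        by (simp only: B_def ip_Cauchy_Schwarz)
    qed
    show "B k \<le> ((\<Sum>\<sigma>\<in>\<Omega>. w \<sigma>) * (L * card V)\<^sup>2) * (\<kappa>\<^sup>2) ^ k" for k
      using ip_le_lipschitz[OF F_mean F_lipschitz, of k]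
      by (simp add: B_def power_mult_distrib mult_ac flip: power_mult)
  qed simp
  then have "B 0 * B 1 \<le> B 0 * (\<kappa>\<^sup>2 * B 0)"
    by (intro mult_left_mono) (simp_all add: B_def ip_nonneg)
  \<comment> \<open>Cauchy-Schwarz once more passes from the norm of \<open>resample p f\<close> to
    the quadratic form.\<close>
  moreover have "(ip f (resample p f))\<^sup>2 \<le> B 0 * B 1"
    using ip_Cauchy_Schwarz[of f "resample p f"] by (simp add: B_def F_def)
  ultimately have "(ip f (resample p f))\<^sup>2 \<le> (\<kappa> * B 0)\<^sup>2"
    by (simp add: power2_eq_square mult_ac)
  moreover have "\<kappa> * B 0 \<ge> 0"
    using \<kappa> by (simp add: B_def ip_nonneg)
  ultimately have "ip f (resample p f) \<le> \<kappa> * B 0"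
    by (rule power2_le_imp_le)
  then show ?thesis
    by (simp add: B_def F_def)
qed

end

subsection \<open>The clue\<close>

lemma space_coord_algebra: "space (coord_algebra M A) = space M"
  unfolding coord_algebra_def by (rule space_measure_of) blast

lemma sets_coord_algebra:
  "sets (coord_algebra M A) =
     sigma_sets (space M) {(\<lambda>\<sigma>. \<sigma> j) -` B \<inter> space M | j B. j \<in> A \<and> B \<in> sets borel}"
  unfolding coord_algebra_def by (rule sets_measure_of) blast

text \<open>The generators do not separate configurations that agree on \<open>A\<close>, and this
  survives complements and countable unions.\<close>

lemma coord_algebra_saturated:
  assumes "S \<in> sets (coord_algebra M A)" "\<sigma> \<in> space M" "\<tau> \<in> space M" "\<And>x. x \<in> A \<Longrightarrow> \<sigma> x = \<tau> x"
  shows "\<sigma> \<in> S \<longleftrightarrow> \<tau> \<in> S"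
  using assms(1) unfolding sets_coord_algebra
proof (induction rule: sigma_sets.induct)
  case (Basic S)
  then show ?case
    using assms by auto
qed (use assms in auto)

text \<open>On a finite space the preimage of any set under \<open>h\<close> is a finite union of
  cylinders over \<open>A\<close>.\<close>

lemma borel_measurable_coord_algebra:
  fixes h :: "('a \<Rightarrow> real) \<Rightarrow> real"
  assumes "finite A" "finite (space M)"
    and h: "\<And>\<sigma> \<tau>. \<sigma> \<in> space M \<Longrightarrow> \<tau> \<in> space M \<Longrightarrow> (\<And>x. x \<in> A \<Longrightarrow> \<sigma> x = \<tau> x) \<Longrightarrow> h \<sigma> = h \<tau>"
  shows "h \<in> borel_measurable (coord_algebra M A)"
proof (rule measurableI)
  fix B :: "real set"
  let ?F = "coord_algebra M A"
  let ?cyl = "\<lambda>\<sigma>. {\<tau> \<in> space ?F. \<forall>x\<in>A. \<tau> x = \<sigma> x}"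
  have "?cyl \<sigma> \<in> sets ?F" for \<sigma>
  proof (rule sets.sets_Collect_finite_All[OF _ assms(1)])
    fix x assume "x \<in> A"
    have "{\<tau> \<in> space ?F. \<tau> x = \<sigma> x} = (\<lambda>\<tau>. \<tau> x) -` {\<sigma> x} \<inter> space M"
      by (auto simp: space_coord_algebra)
    moreover have "\<dots> \<in> sets ?F"
      unfolding sets_coord_algebra
      by (intro sigma_sets.Basic CollectI exI[of _ x] exI[of _ "{\<sigma> x}"]) (use \<open>x \<in> A\<close> in auto)
    ultimately show "{\<tau> \<in> space ?F. \<tau> x = \<sigma> x} \<in> sets ?F"
      by simp
  qed
  then have "(\<Union>\<sigma>\<in>h -` B \<inter> space M. ?cyl \<sigma>) \<in> sets ?F"
    using assms(2) by (intro sets.finite_UN) auto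
  also have "(\<Union>\<sigma>\<in>h -` B \<inter> space M. ?cyl \<sigma>) = h -` B \<inter> space ?F"
  proof (intro equalityI subsetI)
    fix \<tau> assume "\<tau> \<in> (\<Union>\<sigma>\<in>h -` B \<inter> space M. ?cyl \<sigma>)"
    then obtain \<sigma> where \<sigma>: "h \<sigma> \<in> B" "\<sigma> \<in> space M" "\<tau> \<in> space M" "\<And>x. x \<in> A \<Longrightarrow> \<tau> x = \<sigma> x"
      unfolding space_coord_algebra by blast
    then have "h \<tau> = h \<sigma>"
      by (intro h)
    with \<sigma> show "\<tau> \<in> h -` B \<inter> space ?F"
      by (simp add: space_coord_algebra)
  next
    fix \<tau> assume "\<tau> \<in> h -` B \<inter> space ?F"
    then have "\<tau> \<in> h -` B \<inter> space M" "\<tau> \<in> ?cyl \<tau>"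
      by (simp_all add: space_coord_algebra)
    then show "\<tau> \<in> (\<Union>\<sigma>\<in>h -` B \<inter> space M. ?cyl \<sigma>)"
      by (rule UN_I[where B = ?cyl])
  qed
  finally show "h -` B \<inter> space ?F \<in> sets ?F" .
qed simp

section \<open>The Ising measure and its clue in terms of weighted sums\<close>

locale ising_model =
  fixes V :: "'a set" and E :: "'a set set" and \<beta> :: real
  assumes finite_vertices: "finite V"

sublocale ising_model \<subseteq> spin_weight V "ising_weight E \<beta>"
  by unfold_locales (simp_all add: finite_vertices ising_weight_def)

context ising_model
begin

abbreviation "M \<equiv> ising V E \<beta>"
abbreviation "Z \<equiv> \<Sum>\<sigma>\<in>\<Omega>. ising_weight E \<beta> \<sigma>"

lemma space_M [simp]: "space M = \<Omega>"
  by (simp add: ising_def space_point_measure)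

lemma integral_M: "integral\<^sup>L M g = ip g (\<lambda>_. 1) / Z"
proof -
  have "ising_weight E \<beta> \<sigma> / Z \<ge> 0" for \<sigma>
    using total_weight_pos weight_pos[of \<sigma>] by (simp add: less_imp_le)
  then have "integral\<^sup>L M g = (\<Sum>\<sigma>\<in>\<Omega>. (ising_weight E \<beta> \<sigma> / Z) *\<^sub>R g \<sigma>)"
    unfolding ising_def by (intro lebesgue_integral_point_measure_finite finite_\<Omega>)
  then show ?thesis
    by (simp add: ip_def sum_divide_distrib)
qed

lemma integrable_M: "integrable M (g :: _ \<Rightarrow> real)"
  unfolding ising_def by (rule integrable_point_measure_finite[OF finite_\<Omega>])

text \<open>Every configuration has positive mass, so conditional expectations, unique almost
  everywhere, are determined pointwise.\<close>

lemma AE_M: "(AE \<sigma> in M. P \<sigma>) \<longleftrightarrow> (\<forall>\<sigma>\<in>\<Omega>. P \<sigma>)"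
proof -
  have "ising_weight E \<beta> \<sigma> / Z > 0" for \<sigma>
    using total_weight_pos weight_pos[of \<sigma>] by simp
  then show ?thesis
    unfolding ising_def by (auto simp: AE_point_measure)
qed

lemma real_cond_exp_eq_cond:
  assumes "A \<subseteq> V" "\<sigma> \<in> \<Omega>"
  shows "real_cond_exp M (coord_algebra M A) f \<sigma> = cond A f \<sigma>"
proof -
  let ?F = "coord_algebra M A"
  interpret prob_space M
    by (rule prob_space_ising[OF finite_vertices])
  interpret finite_measure_subalgebra M ?F
    by unfold_locales (rule subalgebra_coord_algebra)
  have "AE \<sigma> in M. real_cond_exp M ?F f \<sigma> = cond A f \<sigma>"
  proof (rule real_cond_exp_charact)
    fix S assume S: "S \<in> sets ?F"
    have set_int: "(\<integral>\<sigma>\<in>S. g \<sigma> \<partial>M) = ip g (indicator S) / Z" for g :: "('a \<Rightarrow> real) \<Rightarrow> real"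
      by (simp add: set_lebesgue_integral_def integral_M) (simp add: ip_def mult_ac)
    have "ip (cond A f) (indicator S) = ip f (cond A (indicator S))"
      by (rule ip_cond)
    \<comment> \<open>The indicator of \<open>S\<close> depends on the spins in \<open>A\<close>
      only, so \<open>cond A\<close> fixes it.\<close>
    also have "\<dots> = ip f (indicator S)"
    proof (intro ip_cong refl cond_eqI)
      fix \<sigma> \<tau> assume "\<sigma> \<in> \<Omega>" "\<tau> \<in> \<Omega>" "\<And>x. x \<in> A \<Longrightarrow> \<tau> x = \<sigma> x"
      then show "indicator S \<tau> = (indicator S \<sigma> :: real)"
        using coord_algebra_saturated[OF S, of \<tau> \<sigma>] by (simp add: indicator_def)
    qed
    finally show "(\<integral>\<sigma>\<in>S. f \<sigma> \<partial>M) = (\<integral>\<sigma>\<in>S. cond A f \<sigma> \<partial>M)"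
      by (simp add: set_int)
  next
    show "cond A f \<in> borel_measurable ?F"
    proof (rule borel_measurable_coord_algebra)
      show "finite A"
        using assms(1) finite_vertices by (rule finite_subset)
      show "finite (space M)"
        by (simp add: finite_\<Omega>)
      show "cond A f \<sigma> = cond A f \<tau>"
        if "\<sigma> \<in> space M" "\<tau> \<in> space M" "\<And>x. x \<in> A \<Longrightarrow> \<sigma> x = \<tau> x" for \<sigma> \<tau>
        using that by (intro cond_cong) simp_all
    qed
  qed (rule integrable_M)+
  with assms(2) show ?thesis
    by (simp add: AE_M)
qed

lemma cond_diff_const:
  assumes "\<sigma> \<in> \<Omega>"
  shows "cond A (\<lambda>\<sigma>. f \<sigma> - c) \<sigma> = cond A f \<sigma> - c"
proof -
  have "(\<Sum>\<tau>\<in>configs (V - A) \<sigma>. ising_weight E \<beta> \<tau>) > 0"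
    using finite_V by (intro sum_configs_pos weight_pos) auto
  then show ?thesis
    by (simp add: cond_def avg_def right_diff_distrib sum_subtractf diff_divide_distrib
        flip: sum_distrib_right)
qed

text \<open>The variance of the conditional expectation is the squared norm of the projected centred
  function, that is, a quadratic form linear in the projection. This linearity allows averaging over
  the random set.\<close>

lemma clue_eq_ip:
  fixes f :: "('a \<Rightarrow> real) \<Rightarrow> real"
  assumes "A \<subseteq> V"
  defines "g \<equiv> \<lambda>\<sigma>. f \<sigma> - integral\<^sup>L M f"
  shows "clue M f A = ip g (cond A g) / ip g g"
proof -
  let ?m = "integral\<^sup>L M f"
  let ?h = "real_cond_exp M (coord_algebra M A) f"
  have var: "prob_space.variance M f = ip g g / Z"
    by (simp add: integral_M g_def) (simp add: ip_def power2_eq_square mult_ac)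
  have "integral\<^sup>L M ?h = ip (cond A f) (\<lambda>_. 1) / Z"
    unfolding integral_M
    by (intro arg_cong2[where f = "(/)"] ip_cong) (simp_all add: real_cond_exp_eq_cond assms)
  also have "\<dots> = ?m"
    by (simp add: integral_M ip_cond_one)
  finally have mean: "integral\<^sup>L M ?h = ?m" .
  have "ip (\<lambda>\<sigma>. (?h \<sigma> - ?m)\<^sup>2) (\<lambda>_. 1) = ip (cond A g) (cond A g)"
    unfolding ip_def g_def
    by (intro sum.cong refl)
       (simp add: real_cond_exp_eq_cond[OF assms(1)] cond_diff_const power2_eq_square)
  then have "prob_space.variance M ?h = ip g (cond A g) / Z"
    unfolding mean by (subst integral_M) (simp add: ip_cond_cond)
  \<comment> \<open>If the variance is 0, the clue is 0 by definition and the quotient is 0 as a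
    division by zero.\<close>
  then show ?thesis
    using total_weight_pos by (simp add: clue_def var)
qed

text \<open>Averaging the quadratic forms over the random set turns the expected clue into the
  Rayleigh quotient of \<open>resample p\<close> at the centred function.\<close>

lemma expectation_clue_le:
  assumes p: "set_pmf p \<subseteq> Pow V" and \<kappa>: "\<kappa> \<ge> 0"
    and contraction: "\<And>L f. L \<ge> 0 \<Longrightarrow> flip_lipschitz V L f \<Longrightarrow> flip_lipschitz V (\<kappa> * L) (resample p f)"
  shows "measure_pmf.expectation p (clue M f) \<le> \<kappa>"
proof -
  define g where "g = (\<lambda>\<sigma>. f \<sigma> - integral\<^sup>L M f)"
  have mean: "ip g (\<lambda>_. 1) = 0"
  proof -
    have "ip g (\<lambda>_. 1) = ip f (\<lambda>_. 1) - Z * integral\<^sup>L M f"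
      by (simp add: ip_def g_def right_diff_distrib sum_subtractf flip: sum_distrib_right)
    then show ?thesis
      using total_weight_pos by (simp add: integral_M)
  qed
  have "measure_pmf.expectation p (clue M f) = (\<Sum>A\<in>Pow V. clue M f A * pmf p A)"
    using p finite_vertices by (intro integral_measure_pmf_real) auto
  also have "\<dots> = (\<Sum>A\<in>Pow V. pmf p A * ip (cond A g) g) / ip g g"
    unfolding sum_divide_distrib
  proof (intro sum.cong refl)
    fix A assume "A \<in> Pow V"
    then have "clue M f A = ip g (cond A g) / ip g g"
      unfolding g_def by (intro clue_eq_ip) auto
    then show "clue M f A * pmf p A = pmf p A * ip (cond A g) g / ip g g"
      by (simp add: ip_commute[of "cond A g" g])
  qed
  also have "\<dots> = ip g (resample p g) / ip g g"
    by (simp add: ip_resample_left ip_commute[of g "resample p g"])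
  also have "\<dots> \<le> \<kappa>"
  proof (cases "ip g g = 0")
    case False
    then have "ip g g > 0"
      using ip_nonneg[of g] by simp
    then show ?thesis
      using ip_resample_le[OF \<kappa> contraction mean] by (simp add: divide_le_eq)
  qed (use \<kappa> in simp)
  finally show ?thesis .
qed

end

text \<open>A flip at \<open>x\<close> is felt only by realisations containing \<open>x\<close>,
  which have total probability at most \<open>\<delta>\<close>, and there by at most
  \<open>C * L\<close>. So \<open>resample p\<close> contracts Lipschitz constants by
  \<open>\<delta> * C\<close>.\<close>

lemma expectation_clue_le_density:
  assumes graph: "finite_graph V E"
    and deg: "\<And>x. x \<in> V \<Longrightarrow> vertex_degree E x \<le> d"
    and beta: "\<beta> \<ge> 0" "(real d - 1) * tanh \<beta> < 1"
    and p: "set_pmf p \<subseteq> Pow V"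
    and \<delta>: "\<delta> \<ge> 0" "\<And>x. x \<in> V \<Longrightarrow> measure_pmf.prob p {A. x \<in> A} \<le> \<delta>"
  shows "measure_pmf.expectation p (clue (ising V E \<beta>) f)
    \<le> \<delta> * (1 + d * tanh \<beta> / (1 - (real d - 1) * tanh \<beta>))"
proof -
  define C where "C = 1 + d * tanh \<beta> / (1 - (real d - 1) * tanh \<beta>)"
  have C: "C \<ge> 0"
    using beta by (simp add: C_def)
  interpret ising_model V E \<beta>
    using graph by unfold_locales (simp add: finite_graph_def)
  have "flip_lipschitz V (\<delta> * C * L) (resample p f)" if L: "L \<ge> 0" "flip_lipschitz V L f" for L f
    unfolding flip_lipschitz_def
  proof (intro ballI)
    fix \<sigma> x assume \<sigma>: "\<sigma> \<in> \<Omega>" and x: "x \<in> V"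
    have "\<bar>resample p f (\<sigma>(x := 1)) - resample p f (\<sigma>(x := -1))\<bar>
        = \<bar>\<Sum>A\<in>Pow V. pmf p A * (cond A f (\<sigma>(x := 1)) - cond A f (\<sigma>(x := -1)))\<bar>"
      by (simp add: resample_def right_diff_distrib sum_subtractf)
    also have "\<dots> \<le> (\<Sum>A\<in>Pow V. pmf p A * (if x \<in> A then L * C else 0))"
    proof (intro order_trans[OF sum_abs] sum_mono)
      fix A
      have "\<bar>cond A f (\<sigma>(x := 1)) - cond A f (\<sigma>(x := -1))\<bar> \<le> (if x \<in> A then L * C else 0)"
        unfolding cond_def C_def by (rule avg_lipschitz[OF graph deg beta L \<sigma> x])
      then show "\<bar>pmf p A * (cond A f (\<sigma>(x := 1)) - cond A f (\<sigma>(x := -1)))\<bar>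
          \<le> pmf p A * (if x \<in> A then L * C else 0)"
        unfolding abs_mult abs_of_nonneg[OF pmf_nonneg] by (intro mult_left_mono pmf_nonneg)
    qed
    also have "\<dots> = (\<Sum>A\<in>Pow V. indicator {A. x \<in> A} A * pmf p A) * (L * C)"
      unfolding sum_distrib_right by (intro sum.cong) auto
    also have "(\<Sum>A\<in>Pow V. indicator {A. x \<in> A} A * pmf p A)
        = measure_pmf.expectation p (indicator {A. x \<in> A})"
      using p finite_vertices by (intro integral_measure_pmf_real[symmetric]) auto
    also have "\<dots> = measure_pmf.prob p {A. x \<in> A}"
      by simp
    also have "measure_pmf.prob p {A. x \<in> A} * (L * C) \<le> \<delta> * (L * C)"
      using L C \<delta>(2)[OF x] by (intro mult_right_mono) auto
    also have "\<dots> = \<delta> * C * L"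
      by simp
    finally show "\<bar>resample p f (\<sigma>(x := 1)) - resample p f (\<sigma>(x := -1))\<bar> \<le> \<delta> * C * L" .
  qed
  then show ?thesis
    using p \<delta> C unfolding C_def[symmetric] by (intro expectation_clue_le) auto
qed

section \<open>The threshold condition and the conclusion\<close>

lemma tanh_less_tree_uniqueness_threshold:
  assumes "d \<ge> 2" "ereal \<beta> < tree_uniqueness_threshold d"
  shows "(real d - 1) * tanh \<beta> < 1"
proof (cases "d = 2")
  case True
  \<comment> \<open>Here the threshold is infinite, and \<open>tanh \<beta> < 1\<close> holds for
    every real \<open>\<beta>\<close>.\<close>
  then show ?thesis
    using tanh_real_lt_1[of \<beta>] by simp
next
  case False
  with assms(1) have d: "d \<ge> 3"
    by simp
  obtain b where b: "tree_uniqueness_threshold d = ereal b" "tanh b = 1 / (real d - 1)"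
    using tanh_tree_uniqueness_threshold[OF d] .
  have "tanh \<beta> < tanh b"
    using assms(2) b(1) by simp
  then have "(real d - 1) * tanh \<beta> < (real d - 1) * tanh b"
    using d by (intro mult_strict_left_mono) auto
  with b(2) d show ?thesis
    by simp
qed

theorem theorem1p11:
  fixes V :: "nat \<Rightarrow> 'a set" and E :: "nat \<Rightarrow> 'a set set" and d :: nat and \<beta> :: real
  assumes graph: "\<And>n. finite_graph (V n) (E n)"
    and d: "d \<ge> 2"
    and max_degree: "\<And>n x. x \<in> V n \<Longrightarrow> vertex_degree (E n) x \<le> d"
    and beta_nonneg: "\<beta> \<ge> 0"
    and beta_less: "ereal \<beta> < tree_uniqueness_threshold d"
  shows "\<not> random_sparse_reconstruction V (\<lambda>n. ising (V n) (E n) \<beta>)"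
proof
  assume "random_sparse_reconstruction V (\<lambda>n. ising (V n) (E n) \<beta>)"
  then obtain f :: "nat \<Rightarrow> ('a \<Rightarrow> real) \<Rightarrow> real" and U :: "nat \<Rightarrow> 'a set pmf" and c :: real
    where U: "\<And>n. set_pmf (U n) \<subseteq> Pow (V n)"
      and sparse: "(\<lambda>n. Max ((\<lambda>j. measure_pmf.prob (U n) {A. j \<in> A}) ` V n)) \<longlonglongrightarrow> 0"
      and c: "c > 0" "\<And>n. measure_pmf.expectation (U n) (clue (ising (V n) (E n) \<beta>) (f n)) > c"
    unfolding random_sparse_reconstruction_def by blast
  define C where "C = 1 + d * tanh \<beta> / (1 - (real d - 1) * tanh \<beta>)"
  let ?\<delta> = "\<lambda>n. Max ((\<lambda>j. measure_pmf.prob (U n) {A. j \<in> A}) ` V n)"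
  have threshold: "(real d - 1) * tanh \<beta> < 1"
    using d beta_less by (rule tanh_less_tree_uniqueness_threshold)
  \<comment> \<open>The bound is kept for an arbitrary \<open>\<delta>\<close>, since the maximum of
    the inclusion probabilities is meaningful only once \<open>V n\<close> is known to be
    nonempty.\<close>
  have clue_le: "measure_pmf.expectation (U n) (clue (ising (V n) (E n) \<beta>) (f n)) \<le> \<delta> * C"
    if "\<delta> \<ge> 0" "\<And>j. j \<in> V n \<Longrightarrow> measure_pmf.prob (U n) {A. j \<in> A} \<le> \<delta>" for n \<delta>
    unfolding C_def
    by (rule expectation_clue_le_density[OF graph max_degree beta_nonneg threshold U that])
  have "c \<le> ?\<delta> n * C" for n
  proof -
    have fin: "finite (V n)"
      using graph by (simp add: finite_graph_def)
    \<comment> \<open>For empty \<open>V n\<close> the choice of 0 for \<open>\<delta>\<close> would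
      be admissible and force the expected clue to be at most 0, against
      \<open>c > 0\<close>.\<close>
    have "V n \<noteq> {}"
      using clue_le[of 0 n] c by (smt (verit) empty_iff mult_zero_left)
    then obtain j where "j \<in> V n"
      by blast
    have le: "measure_pmf.prob (U n) {A. j \<in> A} \<le> ?\<delta> n" if "j \<in> V n" for j
      using fin that by (intro Max_ge) auto
    have "?\<delta> n \<ge> 0"
      using le[OF \<open>j \<in> V n\<close>] measure_nonneg order_trans by blast
    from clue_le[OF this le] c(2)[of n] show ?thesis
      by simp
  qed
  moreover have "(\<lambda>n. ?\<delta> n * C) \<longlonglongrightarrow> 0 * C"
    by (intro tendsto_mult sparse tendsto_const)
  ultimately have "c \<le> 0 * C"
    by (intro LIMSEQ_le_const) auto
  with c(1) show False
    by simp
qed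

end
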